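(* If $d,i\to\infty$ with $i\le d/2$, then $$\lambda_1(H_d^i)=2\sqrt{i(d+1-i)}\left(1+O\!\left(i^{-1/2}\log^{1/2} i\right)\right).$$
   Context: $Q_d$ is the $d$-dimensional hypercube with vertex set the subsets of $[d]=\{1,\dots,d\}$ (identified with $\{0,1\}^d$), two vertices adjacent iff their symmetric difference has size one. The Hamming ball $H_d^i$ is the subgraph of $Q_d$ induced by all subsets of $[d]$ of size at most $i$. $\lambda_1(G)$ denotes the largest eigenvalue of the adjacency matrix of a graph $G$. *)

theory Defs
  imports
    "HOL-Library.Landau_Symbols"
    "Graph_Theory.Graph_Theory"
    "Jordan_Normal_Form.Spectral_Radius"
begin

text \<open>
  Simple graphs are represented, as is usual in the library, by symmetric loopfree digraphs;
  each edge corresponds to two opposite arcs (see \<open>pair_graph_hypercube\<close> below).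
\<close>

definition hypercube :: "nat \<Rightarrow> nat set pair_pre_digraph" where
  "hypercube d = \<lparr> pverts = Pow {1..d},
     parcs = {(A, B). A \<in> Pow {1..d} \<and> B \<in> Pow {1..d} \<and> card ((A - B) \<union> (B - A)) = 1} \<rparr>"

definition hamming_ball :: "nat \<Rightarrow> nat \<Rightarrow> (nat set, nat set \<times> nat set) pre_digraph" where
  "hamming_ball d i = with_proj (hypercube d) \<restriction> {A. A \<subseteq> {1..d} \<and> card A \<le> i}"

definition adj_matrix :: "('a, 'b) pre_digraph \<Rightarrow> 'a list \<Rightarrow> real mat" where
  "adj_matrix G vs =
     mat (length vs) (length vs) (\<lambda>(j, k). if vs ! j \<rightarrow>\<^bsub>G\<^esub> vs ! k then 1 else 0)"

text \<open>
  Matrices are indexed by natural numbers, so an enumeration of the vertices has to be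
  chosen; the value does not depend on it, see \<open>lambda1_eq\<close>. The adjacency matrix of a
  graph is real symmetric, so that its spectrum over the reals is its full spectrum.
\<close>

definition lambda1 :: "('a, 'b) pre_digraph \<Rightarrow> real" where
  "lambda1 G =
     Max (spectrum (adj_matrix G (SOME vs. distinct vs \<and> set vs = verts G)))"

text \<open>The limiting regime: \<open>d\<close> and \<open>i\<close> tend to infinity subject to \<open>i \<le> d / 2\<close>.\<close>

definition half_filter :: "(nat \<times> nat) filter" where
  "half_filter = inf (at_top \<times>\<^sub>F at_top) (principal {(d, i). real i \<le> real d / 2})"

lemma eventually_half_filter:
  "eventually P half_filter \<longleftrightarrow>
     (\<exists>N. \<forall>d\<ge>N. \<forall>i\<ge>N. real i \<le> real d / 2 \<longrightarrow> P (d, i))"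
  unfolding half_filter_def eventually_inf_principal
  by (simp add: eventually_prod_sequentially) blast

lemma half_filter_nontrivial: "half_filter \<noteq> bot"
proof
  assume "half_filter = bot"
  then have "eventually (\<lambda>_. False) half_filter" by simp
  then obtain N where "\<forall>d\<ge>N. \<forall>i\<ge>N. \<not> real i \<le> real d / 2"
    by (auto simp: eventually_half_filter)
  from this[rule_format, of "2 * N" N] show False by simp
qed

lemma pair_graph_hypercube: "pair_graph (hypercube d)"
proof
  show "finite (parcs (hypercube d))"
    by (rule finite_subset[of _ "Pow {1..d} \<times> Pow {1..d}"]) (auto simp: hypercube_def)
  show "symmetric (with_proj (hypercube d))"
    unfolding symmetric_def by (auto simp: hypercube_def sym_def Un_commute)
qed (auto simp: hypercube_def)

lemma induced_subgraph_hamming_ball: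
  "induced_subgraph (hamming_ball d i) (with_proj (hypercube d))"
proof -
  interpret pair_graph "hypercube d" by (rule pair_graph_hypercube)
  show ?thesis
    unfolding hamming_ball_def by (rule induced_induce) (auto simp: hypercube_def)
qed

lemma eigenvalue_adj_matrix_iff:
  assumes "distinct vs"
  shows "eigenvalue (adj_matrix G vs) k \<longleftrightarrow>
    (\<exists>x. (\<exists>v\<in>set vs. x v \<noteq> 0) \<and>
         (\<forall>v\<in>set vs. (\<Sum>u\<in>set vs. if v \<rightarrow>\<^bsub>G\<^esub> u then x u else 0) = k * x v))"
    (is "?L \<longleftrightarrow> ?R")
proof -
  let ?n = "length vs" and ?A = "adj_matrix G vs"
  have bij: "bij_betw ((!) vs) {0..<?n} (set vs)"
    using bij_betw_nth[OF assms, of "{0..<?n}" "set vs"] by (simp add: atLeast0LessThan)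
  have mult: "(?A *\<^sub>v y) $ j = (\<Sum>u\<in>set vs. if vs ! j \<rightarrow>\<^bsub>G\<^esub> u then x u else 0)"
    if y: "y \<in> carrier_vec ?n" "\<And>l. l < ?n \<Longrightarrow> y $ l = x (vs ! l)" and j: "j < ?n" for x y j
  proof -
    have "(?A *\<^sub>v y) $ j = (\<Sum>l\<in>{0..<?n}. if vs ! j \<rightarrow>\<^bsub>G\<^esub> vs ! l then x (vs ! l) else 0)"
      using y j by (auto simp: adj_matrix_def scalar_prod_def intro!: sum.cong)
    also have "\<dots> = (\<Sum>u\<in>set vs. if vs ! j \<rightarrow>\<^bsub>G\<^esub> u then x u else 0)"
      by (rule sum.reindex_bij_betw[OF bij])
    finally show ?thesis .
  qed
  have dim [simp]: "dim_row ?A = ?n" by (simp add: adj_matrix_def)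
  show ?thesis
  proof
    assume ?L
    then obtain y where y: "y \<in> carrier_vec ?n" "y \<noteq> 0\<^sub>v ?n" "?A *\<^sub>v y = k \<cdot>\<^sub>v y"
      by (auto simp: eigenvalue_def eigenvector_def)
    define x where "x v = y $ (the_inv_into {0..<?n} ((!) vs) v)" for v
    have x: "y $ l = x (vs ! l)" if "l < ?n" for l
      using that the_inv_into_f_f[OF bij_betw_imp_inj_on[OF bij], of l] by (simp add: x_def)
    have "\<exists>l<?n. y $ l \<noteq> 0" using y(1,2) by (metis eq_vecI carrier_vecD index_zero_vec)
    then have "\<exists>v\<in>set vs. x v \<noteq> 0" using x by (metis nth_mem)
    moreover have "(\<Sum>u\<in>set vs. if vs ! j \<rightarrow>\<^bsub>G\<^esub> u then x u else 0) = k * x (vs ! j)"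
      if "j < ?n" for j
      using mult[OF y(1) x that] y(1,3) x[OF that] that by simp
    ultimately show ?R by (intro exI[of _ x]) (auto simp: in_set_conv_nth)
  next
    assume ?R
    then obtain x where x: "\<exists>v\<in>set vs. x v \<noteq> 0"
      "\<And>v. v \<in> set vs \<Longrightarrow> (\<Sum>u\<in>set vs. if v \<rightarrow>\<^bsub>G\<^esub> u then x u else 0) = k * x v" by blast
    define y where "y = vec ?n (\<lambda>l. x (vs ! l))"
    have "y \<noteq> 0\<^sub>v ?n" using x(1) by (auto simp: y_def in_set_conv_nth vec_eq_iff)
    moreover have "?A *\<^sub>v y = k \<cdot>\<^sub>v y"
      using mult[of y x] x(2) by (intro eq_vecI) (auto simp: y_def)
    ultimately show ?L
      unfolding eigenvalue_def eigenvector_def by (intro exI[of _ y]) (auto simp: y_def)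
  qed
qed

lemma lambda1_eq:
  assumes "distinct vs" "set vs = verts G"
  shows "lambda1 G = Max (spectrum (adj_matrix G vs))"
proof -
  define ws where "ws = (SOME vs. distinct vs \<and> set vs = verts G)"
  have "distinct ws \<and> set ws = verts G"
    unfolding ws_def by (rule someI[of _ vs]) (use assms in auto)
  then have "spectrum (adj_matrix G ws) = spectrum (adj_matrix G vs)"
    using assms unfolding spectrum_def
    by (intro Collect_cong) (simp add: eigenvalue_adj_matrix_iff[of ws] eigenvalue_adj_matrix_iff[of vs])
  then show ?thesis by (simp add: lambda1_def ws_def)
qed

end

theory Submission
  imports Defs
begin

text \<open>
  Write $b_k = \sqrt{k(d+1-k)}$, which increases in $k$ as long as $k \le d/2$.
  A positive weight depending only on the level of a vertex turns the adjacency operator into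
  a weighted path. The weight $\binom{d}{k}^{-1/2}$ gives weighted degree $b_k + b_{k+1}$ on
  level $k$, whence $\lambda_1 \le 2 b_i$.

  For the lower bound, let $f_\mu$ be the solution of the three-term recurrence
  $k f_\mu(k-1) + (d-k) f_\mu(k+1) = \mu f_\mu(k)$ with $f_\mu(0) = 1$, and let $\mu^*$ be the
  infimum of those $\mu$ for which $f_\mu$ is positive on the levels $0, \dots, i+1$. At
  $\mu^*$ the only level on which $f$ can vanish is $i+1$, so $\mu^*$ is an eigenvalue of the
  ball. If $f_\mu$ is positive, then dividing the recurrence by $f_\mu(k)$ and summing over
  $i-s \le k \le i$ gives, by AM-GM for consecutive levels,
  $(s+1) \mu \ge 2 s b_{i-s+1}$. The choice $s = \lfloor\sqrt i\rfloor$ yields even the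
  relative error $O(i^{-1/2})$.
\<close>

section \<open>Eigenvalues through functions on the vertices\<close>

definition graph_eigenvalue :: "('a, 'b) pre_digraph \<Rightarrow> real \<Rightarrow> bool" where
  "graph_eigenvalue G \<mu> \<longleftrightarrow>
    (\<exists>x. (\<exists>v\<in>verts G. x v \<noteq> 0) \<and>
         (\<forall>v\<in>verts G. (\<Sum>u\<in>verts G. if v \<rightarrow>\<^bsub>G\<^esub> u then x u else 0) = \<mu> * x v))"

text \<open>\<open>Max\<close> returns a member of a finite set only if the set is nonempty; the
  given eigenvalue \<open>\<mu>\<close> ensures this.\<close>

lemma lambda1_greatest_eigenvalue:
  assumes "finite (verts G)" "graph_eigenvalue G \<mu>"
  shows "graph_eigenvalue G (lambda1 G)" "\<mu> \<le> lambda1 G"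
proof -
  obtain vs where vs: "distinct vs" "set vs = verts G"
    using finite_distinct_list[OF assms(1)] by blast
  let ?A = "adj_matrix G vs"
  have spec: "spectrum ?A = Collect (graph_eigenvalue G)"
    by (auto simp: spectrum_def eigenvalue_adj_matrix_iff[OF vs(1)] graph_eigenvalue_def vs(2))
  have "?A \<in> carrier_mat (length vs) (length vs)" by (simp add: adj_matrix_def)
  then have fin: "finite (spectrum ?A)" by (rule card_finite_spectrum)
  have mem: "\<mu> \<in> spectrum ?A" using assms(2) spec by simp
  show "\<mu> \<le> lambda1 G" unfolding lambda1_eq[OF vs] by (rule Max_ge[OF fin mem])
  have "lambda1 G \<in> spectrum ?A" unfolding lambda1_eq[OF vs] using fin mem by (intro Max_in) auto
  then show "graph_eigenvalue G (lambda1 G)" using spec by simp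
qed

text \<open>Collatz-Wielandt argument: take absolute values in the eigenvalue equation at a vertex
  where the ratio of |x| to \<open>w\<close> is maximal.\<close>

lemma graph_eigenvalue_le:
  assumes fin: "finite (verts G)" and eig: "graph_eigenvalue G \<mu>"
    and pos: "\<And>v. v \<in> verts G \<Longrightarrow> w v > 0"
    and super: "\<And>v. v \<in> verts G \<Longrightarrow>
      (\<Sum>u\<in>verts G. if v \<rightarrow>\<^bsub>G\<^esub> u then w u else 0) \<le> M * w v"
  shows "\<mu> \<le> M"
proof -
  obtain x where x: "\<exists>v\<in>verts G. x v \<noteq> 0"
    "\<And>v. v \<in> verts G \<Longrightarrow> (\<Sum>u\<in>verts G. if v \<rightarrow>\<^bsub>G\<^esub> u then x u else 0) = \<mu> * x v"
    using eig unfolding graph_eigenvalue_def by blast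
  define q where "q v = \<bar>x v\<bar> / w v" for v
  have ne: "q ` verts G \<noteq> {}" using x(1) by auto
  obtain v where v: "v \<in> verts G" "q v = Max (q ` verts G)"
    using Max_in[OF finite_imageI[OF fin] ne] by auto
  have le: "q u \<le> q v" if "u \<in> verts G" for u using v(2) fin that by simp
  have xw: "\<bar>x u\<bar> = q u * w u" if "u \<in> verts G" for u
    using pos[OF that] by (simp add: q_def)
  obtain u where u: "u \<in> verts G" "x u \<noteq> 0" using x(1) by blast
  have "q u > 0" using u pos[OF u(1)] by (simp add: q_def)
  then have qv: "q v > 0" using le[OF u(1)] by simp
  have "\<mu> * (q v * w v) \<le> \<bar>\<mu> * x v\<bar>"
    using xw[OF v(1)] by (simp add: abs_mult mult_right_mono flip: xw[OF v(1)])
  also have "\<dots> \<le> (\<Sum>u\<in>verts G. \<bar>if v \<rightarrow>\<^bsub>G\<^esub> u then x u else 0\<bar>)"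
    unfolding x(2)[OF v(1), symmetric] by (rule sum_abs)
  also have "\<dots> \<le> (\<Sum>u\<in>verts G. q v * (if v \<rightarrow>\<^bsub>G\<^esub> u then w u else 0))"
    using le pos by (intro sum_mono) (auto simp: xw intro!: mult_right_mono less_imp_le)
  also have "\<dots> \<le> q v * (M * w v)"
    unfolding sum_distrib_left[symmetric] using super[OF v(1)] qv by simp
  finally have "\<mu> * (q v * w v) \<le> M * (q v * w v)" by (simp add: mult_ac)
  then show ?thesis using qv pos[OF v(1)] by simp
qed

section \<open>Neighbourhoods in the Hamming ball\<close>

lemma verts_hamming_ball: "verts (hamming_ball d i) = {A. A \<subseteq> {1..d} \<and> card A \<le> i}"
  by (simp add: hamming_ball_def)

lemma finite_verts_hamming_ball: "finite (verts (hamming_ball d i))"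
  unfolding verts_hamming_ball by (rule finite_subset[of _ "Pow {1..d}"]) auto

lemma adj_hamming_ball:
  "A \<rightarrow>\<^bsub>hamming_ball d i\<^esub> B \<longleftrightarrow>
    A \<in> verts (hamming_ball d i) \<and> B \<in> verts (hamming_ball d i) \<and>
    card ((A - B) \<union> (B - A)) = 1"
  by (auto simp: hamming_ball_def hypercube_def arcs_ends_def arc_to_ends_def)

lemma card_sym_diff_eq_1_iff:
  "card ((A - B) \<union> (B - A)) = 1 \<longleftrightarrow> (\<exists>x\<in>A. B = A - {x}) \<or> (\<exists>x. x \<notin> A \<and> B = insert x A)"
  (is "?L \<longleftrightarrow> ?R")
proof
  assume ?L
  then obtain x where "(A - B) \<union> (B - A) = {x}" by (auto simp: card_1_singleton_iff)
  then have x: "z \<in> B \<longleftrightarrow> (z \<in> A) \<noteq> (z = x)" for z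
    by (metis Diff_iff Un_iff singleton_iff)
  then have "B = (if x \<in> A then A - {x} else insert x A)" by (auto simp: set_eq_iff)
  then show ?R by (cases "x \<in> A") auto
next
  assume ?R
  then obtain x where "(A - B) \<union> (B - A) = {x}" by fastforce
  then show ?L by simp
qed

text \<open>Deleting an element of \<open>A\<close> gives the lower neighbours, inserting a new
  point the upper ones; the ball contains the latter only below level \<open>i\<close>. At the empty
  set the truncated \<open>card A - 1\<close> is multiplied by 0.\<close>

lemma sum_radial_hamming_ball:
  fixes g :: "nat \<Rightarrow> real"
  assumes A: "A \<in> verts (hamming_ball d i)"
  shows "(\<Sum>B\<in>verts (hamming_ball d i). if A \<rightarrow>\<^bsub>hamming_ball d i\<^esub> B then g (card B) else 0) =
    real (card A) * g (card A - 1) +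
    (if card A < i then (real d - real (card A)) * g (card A + 1) else 0)"
proof -
  let ?V = "verts (hamming_ball d i)" and ?k = "card A"
  have sub: "A \<subseteq> {1..d}" and k: "?k \<le> i" using A by (auto simp: verts_hamming_ball)
  have finA: "finite A" using sub finite_subset by blast
  define D where "D = (\<lambda>x. A - {x}) ` A"
  define U where "U = (if ?k < i then (\<lambda>x. insert x A) ` ({1..d} - A) else {})"
  have N: "{B \<in> ?V. A \<rightarrow>\<^bsub>hamming_ball d i\<^esub> B} = D \<union> U"
  proof (rule Set.set_eqI)
    fix B
    have "B \<in> D \<longleftrightarrow> B \<in> ?V \<and> (\<exists>x\<in>A. B = A - {x})"
    proof -
      have "A - {x} \<in> ?V" for x
        using sub k card_Diff1_le[of A x] by (auto simp: verts_hamming_ball)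
      then show ?thesis by (auto simp: D_def)
    qed
    moreover have "B \<in> U \<longleftrightarrow> B \<in> ?V \<and> (\<exists>x. x \<notin> A \<and> B = insert x A)"
    proof -
      have "insert x A \<in> ?V \<longleftrightarrow> x \<in> {1..d} \<and> ?k < i" if "x \<notin> A" for x
        using sub finA that by (auto simp: verts_hamming_ball)
      then show ?thesis by (auto simp: U_def)
    qed
    ultimately have "B \<in> D \<union> U \<longleftrightarrow>
        B \<in> ?V \<and> ((\<exists>x\<in>A. B = A - {x}) \<or> (\<exists>x. x \<notin> A \<and> B = insert x A))"
      by blast
    then show "B \<in> {B \<in> ?V. A \<rightarrow>\<^bsub>hamming_ball d i\<^esub> B} \<longleftrightarrow> B \<in> D \<union> U"
      using A unfolding adj_hamming_ball card_sym_diff_eq_1_iff by simp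
  qed
  have disj: "D \<inter> U = {}" by (auto simp: D_def U_def)
  have fin: "finite D" "finite U" using finA by (auto simp: D_def U_def)
  have sD: "(\<Sum>B\<in>D. g (card B)) = real ?k * g (?k - 1)"
  proof -
    have "inj_on (\<lambda>x. A - {x}) A" by (rule inj_onI) blast
    then show ?thesis using finA by (simp add: D_def sum.reindex card_Diff_singleton)
  qed
  have sU: "(\<Sum>B\<in>U. g (card B)) = (if ?k < i then (real d - real ?k) * g (?k + 1) else 0)"
  proof -
    have "inj_on (\<lambda>x. insert x A) ({1..d} - A)" by (rule inj_onI) blast
    moreover have "card ({1..d} - A) = d - ?k" "?k \<le> d"
      using sub finA card_mono[OF _ sub] by (simp_all add: card_Diff_subset)
    ultimately show ?thesis using finA by (simp add: U_def sum.reindex of_nat_diff)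
  qed
  have "(\<Sum>B\<in>?V. if A \<rightarrow>\<^bsub>hamming_ball d i\<^esub> B then g (card B) else 0) =
      (\<Sum>B\<in>D \<union> U. g (card B))"
    unfolding N[symmetric] by (simp add: sum.inter_filter finite_verts_hamming_ball)
  also have "\<dots> = (\<Sum>B\<in>D. g (card B)) + (\<Sum>B\<in>U. g (card B))"
    using fin disj by (rule sum.union_disjoint)
  finally show ?thesis by (simp add: sD sU)
qed

section \<open>Upper bound from a weight on the levels\<close>

text \<open>Geometric mean of the \<open>k\<close> downward neighbours of a vertex on level
  \<open>k\<close> and the \<open>d + 1 - k\<close> upward neighbours of one on level
  \<open>k - 1\<close>: the entry coupling these levels in the symmetrised path.\<close>

definition level_weight :: "nat \<Rightarrow> nat \<Rightarrow> real" where
  "level_weight d k = sqrt (real k * (real d + 1 - real k))"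

text \<open>The radicands differ by \<open>(i - k) * (d + 1 - i - k)\<close>.\<close>

lemma level_weight_mono:
  assumes "k \<le> i" "2 * i \<le> d"
  shows "level_weight d k \<le> level_weight d i"
proof -
  have "0 \<le> (real i - real k) * (real d + 1 - real i - real k)"
    using assms by (intro mult_nonneg_nonneg) auto
  then show ?thesis by (simp add: level_weight_def algebra_simps)
qed

lemma level_weight_nonneg: "k \<le> d \<Longrightarrow> 0 \<le> level_weight d k"
  by (simp add: level_weight_def)

lemma hamming_ball_eigenvalue_le:
  assumes "2 * i \<le> d" and "graph_eigenvalue (hamming_ball d i) \<mu>"
  shows "\<mu> \<le> 2 * level_weight d i"
proof (rule graph_eigenvalue_le[OF finite_verts_hamming_ball assms(2)])
  \<comment> \<open>This is $\binom{d}{k}^{-1/2}$ in product form.\<close>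
  define w where "w k = (\<Prod>j<k. sqrt ((real j + 1) / (real d - real j)))" for k
  have wpos: "w k > 0" if "k \<le> i" for k
    unfolding w_def using that assms(1) by (intro prod_pos) auto
  \<comment> \<open>The ratio of consecutive values of \<open>w\<close> is chosen so that the
    coupling of two adjacent levels gets the same coefficient upwards (\<open>up\<close>) and
    downwards (\<open>down\<close>).\<close>
  have up: "(real d - real k) * w (k + 1) = level_weight d (k + 1) * w k" if "k < i" for k
  proof -
    have "(real d - real k) * sqrt ((real k + 1) / (real d - real k)) =
        sqrt ((real d - real k) ^ 2 * ((real k + 1) / (real d - real k)))"
      using that assms(1) by (simp add: real_sqrt_mult real_sqrt_divide)
    also have "\<dots> = level_weight d (k + 1)"
      using that assms(1) by (simp add: level_weight_def power2_eq_square mult_ac)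
    finally show ?thesis by (simp add: w_def mult_ac)
  qed
  have down: "real k * w (k - 1) = level_weight d k * w k" if "k \<le> i" for k
  proof (cases k)
    case 0
    then show ?thesis by (simp add: level_weight_def)
  next
    case (Suc l)
    have "level_weight d (Suc l) * sqrt ((real l + 1) / (real d - real l)) =
        sqrt ((real l + 1) ^ 2)"
      using that Suc assms(1)
      by (simp add: level_weight_def power2_eq_square add.commute flip: real_sqrt_mult)
    then have "level_weight d (Suc l) * sqrt ((real l + 1) / (real d - real l)) = real l + 1"
      by simp
    then show ?thesis using Suc by (simp add: w_def mult_ac)
  qed
  fix A assume A: "A \<in> verts (hamming_ball d i)"
  then have k: "card A \<le> i" by (simp add: verts_hamming_ball)
  then show "w (card A) > 0" by (rule wpos)
  have "(\<Sum>B\<in>verts (hamming_ball d i). if A \<rightarrow>\<^bsub>hamming_ball d i\<^esub> B then w (card B) else 0) =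
      (level_weight d (card A) + (if card A < i then level_weight d (card A + 1) else 0)) * w (card A)"
    using down[OF k] up[of "card A"] by (subst sum_radial_hamming_ball[OF A]) (auto simp: distrib_right)
  also have "\<dots> \<le> (2 * level_weight d i) * w (card A)"
  proof (rule mult_right_mono)
    \<comment> \<open>On level \<open>i\<close> the second summand is absent; nonnegativity of
      \<open>level_weight d i\<close> covers that case.\<close>
    show "level_weight d (card A) + (if card A < i then level_weight d (card A + 1) else 0)
        \<le> 2 * level_weight d i"
      using level_weight_mono[OF k assms(1)] level_weight_mono[of "card A + 1" i d] assms(1)
        level_weight_nonneg[of i d] by auto
  qed (use wpos[OF k] in simp)
  finally show "(\<Sum>B\<in>verts (hamming_ball d i).
      if A \<rightarrow>\<^bsub>hamming_ball d i\<^esub> B then w (card B) else 0) \<le> 2 * level_weight d i * w (card A)" .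
qed

section \<open>Radial solutions and their positivity\<close>

text \<open>For \<open>k \<le> d\<close> this is the \<open>k\<close>-th Krawtchouk polynomial at
  \<open>(d - \<mu>) / 2\<close>, divided by the binomial coefficient of \<open>d\<close> and
  \<open>k\<close>. The second clause is the recurrence on level 0, where the downward term
  vanishes.\<close>

fun radial :: "nat \<Rightarrow> real \<Rightarrow> nat \<Rightarrow> real" where
  "radial d \<mu> 0 = 1"
| "radial d \<mu> (Suc 0) = \<mu> / real d"
| "radial d \<mu> (Suc (Suc k)) =
    (\<mu> * radial d \<mu> (Suc k) - (real k + 1) * radial d \<mu> k) / (real d - (real k + 1))"

lemma radial_rec:
  assumes "k < d"
  shows "real k * radial d \<mu> (k - 1) + (real d - real k) * radial d \<mu> (k + 1) = \<mu> * radial d \<mu> k"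
  using assms by (cases k) (auto simp: add.commute)

lemma continuous_on_radial: "continuous_on S (\<lambda>\<mu>. radial d \<mu> k)"
  by (induction k rule: induct_nat_012)
    (auto simp: divide_inverse intro!: continuous_intros)

text \<open>For \<open>\<mu> = d\<close> the recurrence makes each value a weighted mean of its two
  neighbours, so an increase before a level forces one after it. Positivity here exhibits one
  admissible \<open>\<mu>\<close>.\<close>

lemma radial_dim_mono:
  "k < d \<Longrightarrow> 0 < radial d (real d) k \<and> radial d (real d) k \<le> radial d (real d) (Suc k)"
proof (induction k)
  case (Suc k)
  let ?f = "radial d (real d)"
  have IH: "0 < ?f k" "?f k \<le> ?f (Suc k)" using Suc by auto
  have "(real d - real (Suc k)) * ?f (Suc (Suc k)) = real d * ?f (Suc k) - real (Suc k) * ?f k"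
    using radial_rec[of "Suc k" d "real d"] Suc.prems by simp
  also have "\<dots> \<ge> (real d - real (Suc k)) * ?f (Suc k)"
    using mult_left_mono[OF IH(2), of "real (Suc k)"] by (simp add: algebra_simps)
  finally have "?f (Suc k) \<le> ?f (Suc (Suc k))"
    using Suc.prems by (subst (asm) mult_le_cancel_left_pos) (auto simp del: radial.simps)
  then show ?case using IH by simp
qed auto

lemma radial_pos_lower_bound:
  assumes "i < d" "s \<le> i" "2 * i \<le> d" and pos: "\<And>k. k \<le> Suc i \<Longrightarrow> radial d \<mu> k > 0"
  shows "2 * real s * level_weight d (i - s + 1) \<le> (real s + 1) * \<mu>"
proof -
  let ?f = "radial d \<mu>"
  define m where "m = i - s"
  \<comment> \<open>The shares of the lower and the upper neighbours in \<open>\<mu>\<close> on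
    level \<open>k\<close>.\<close>
  define p where "p k = real k * ?f (k - 1) / ?f k" for k
  define q where "q k = (real d - real k) * ?f (k + 1) / ?f k" for k
  have pq: "p k + q k = \<mu>" if "k \<le> i" for k
    using radial_rec[of k d \<mu>] that assms(1) pos[of k]
    by (simp add: p_def q_def flip: add_divide_distrib)
  have p0: "p k \<ge> 0" if "k \<le> i" for k
    unfolding p_def using that pos[of k] pos[of "k - 1"]
    by (intro divide_nonneg_pos mult_nonneg_nonneg) (auto intro: less_imp_le)
  have q0: "q k \<ge> 0" if "k \<le> i" for k
    unfolding q_def using that pos[of k] pos[of "k + 1"] assms(1)
    by (intro divide_nonneg_pos mult_nonneg_nonneg) (auto intro: less_imp_le)
  have amgm: "2 * level_weight d (k + 1) \<le> q k + p (k + 1)" if "k < i" for k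
  proof -
    \<comment> \<open>The values of \<open>radial\<close> cancel in this product, so AM-GM gives a
      bound independent of the solution.\<close>
    have "q k * p (k + 1) = (real k + 1) * (real d - real k)"
      using pos[of k] pos[of "k + 1"] that by (simp add: p_def q_def)
    then have "level_weight d (k + 1) = sqrt (q k * p (k + 1))"
      by (simp add: level_weight_def)
    then show ?thesis
      using arith_geo_mean_sqrt[of "q k" "p (k + 1)"] q0[of k] p0[of "k + 1"] that by simp
  qed
  have step: "2 * level_weight d (m + 1) \<le> q k + p (k + 1)" if "m \<le> k" "k < i" for k
    using amgm[OF that(2)] level_weight_mono[of "m + 1" "k + 1" d] that assms(3) by simp
  \<comment> \<open>The term \<open>q (m + t)\<close> is carried along to be paired with
    \<open>p\<close> on the next level. Thus \<open>s + 1\<close> levels yield \<open>s\<close>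
    pairs, and only \<open>p m\<close> and \<open>q i\<close> are discarded.\<close>
  have "2 * real t * level_weight d (m + 1) + q (m + t) \<le> (real t + 1) * \<mu>" if "t \<le> s" for t
    using that
  proof (induction t)
    case 0
    then show ?case using pq[of m] p0[of m] by (simp add: m_def)
  next
    case (Suc t)
    have "m + t < i" using Suc.prems assms(2) by (simp add: m_def)
    then show ?case using Suc step[of "m + t"] pq[of "m + t + 1"] by (simp add: algebra_simps)
  qed
  from this[of s] show ?thesis using q0[of i] assms(2) by (simp add: m_def)
qed

section \<open>A large eigenvalue at the threshold of positivity\<close>

text \<open>The zero on level \<open>i + 1\<close> cancels exactly the upward term that the ball
  lacks on level \<open>i\<close>; the value 1 at the empty set makes the eigenfunction
  nonzero.\<close>

lemma hamming_ball_radial_eigenvalue: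
  assumes "i < d" "radial d \<mu> (Suc i) = 0"
  shows "graph_eigenvalue (hamming_ball d i) \<mu>"
  unfolding graph_eigenvalue_def
proof (intro exI[of _ "\<lambda>A. radial d \<mu> (card A)"] conjI ballI)
  show "\<exists>v\<in>verts (hamming_ball d i). radial d \<mu> (card v) \<noteq> 0"
    by (rule bexI[of _ "{}"]) (auto simp: verts_hamming_ball)
  fix A assume A: "A \<in> verts (hamming_ball d i)"
  then have k: "card A \<le> i" by (simp add: verts_hamming_ball)
  show "(\<Sum>B\<in>verts (hamming_ball d i).
      if A \<rightarrow>\<^bsub>hamming_ball d i\<^esub> B then radial d \<mu> (card B) else 0) = \<mu> * radial d \<mu> (card A)"
    using radial_rec[of "card A" d \<mu>] k assms
    by (subst sum_radial_hamming_ball[OF A]) (cases "card A = i", auto)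
qed

lemma hamming_ball_eigenvalue_ge:
  assumes "i < d" "s \<le> i" "2 * i \<le> d"
  shows "\<exists>\<mu>. graph_eigenvalue (hamming_ball d i) \<mu> \<and>
    2 * real s * level_weight d (i - s + 1) \<le> (real s + 1) * \<mu>"
proof -
  define S where "S = {\<mu>. \<forall>k\<in>{..Suc i}. radial d \<mu> k > 0}"
  \<comment> \<open>Division by \<open>s + 1\<close> turns the estimate into a lower bound of
    \<open>S\<close>, which passes to the infimum.\<close>
  define L where "L = 2 * real s * level_weight d (i - s + 1) / (real s + 1)"
  have L_iff: "L \<le> \<mu> \<longleftrightarrow> 2 * real s * level_weight d (i - s + 1) \<le> (real s + 1) * \<mu>" for \<mu>
    by (simp add: L_def field_simps)
  have lb: "L \<le> \<mu>" if "\<mu> \<in> S" for \<mu>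
    unfolding L_iff by (rule radial_pos_lower_bound[OF assms]) (use that in \<open>auto simp: S_def\<close>)
  have "radial d (real d) k > 0" if "k \<le> Suc i" for k
    using radial_dim_mono[of "k - 1" d] that assms(1) by (cases k) auto
  then have ne: "S \<noteq> {}" unfolding S_def by auto
  have bdd: "bdd_below S" using lb by (rule bdd_belowI)
  have "open S"
  proof -
    have "S = (\<Inter>k\<in>{..Suc i}. {\<mu>. 0 < radial d \<mu> k})" by (auto simp: S_def)
    then show ?thesis by (auto intro!: open_INT open_Collect_less continuous_on_radial continuous_intros)
  qed
  define \<mu> where "\<mu> = Inf S"
  \<comment> \<open>A negative value at the infimum would persist on a neighbourhood, which meets
    \<open>S\<close>.\<close>
  have nonneg: "radial d \<mu> k \<ge> 0" if "k \<le> Suc i" for k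
  proof (rule ccontr)
    assume "\<not> radial d \<mu> k \<ge> 0"
    moreover have "open {\<mu>. radial d \<mu> k < 0}"
      by (intro open_Collect_less continuous_on_radial continuous_intros)
    ultimately obtain e where e: "e > 0" "\<And>\<nu>. dist \<nu> \<mu> < e \<Longrightarrow> radial d \<nu> k < 0"
      unfolding open_dist by force
    obtain \<nu> where \<nu>: "\<nu> \<in> S" "\<nu> < \<mu> + e"
      using cInf_lessD[OF ne, of "\<mu> + e"] e(1) by (auto simp: \<mu>_def)
    have "\<mu> \<le> \<nu>" unfolding \<mu>_def using \<nu>(1) bdd by (rule cInf_lower)
    then have "radial d \<nu> k < 0" using \<nu>(2) by (intro e(2)) (simp add: dist_real_def)
    then show False using \<nu>(1) that by (force simp: S_def)
  qed
  \<comment> \<open>The open set \<open>S\<close> cannot contain its infimum.\<close>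
  have "\<mu> \<notin> S"
  proof
    assume "\<mu> \<in> S"
    then obtain e where e: "e > 0" "\<And>\<nu>. dist \<nu> \<mu> < e \<Longrightarrow> \<nu> \<in> S"
      using \<open>open S\<close> unfolding open_dist by blast
    have "\<mu> - e / 2 \<in> S" using e(1) by (intro e(2)) (simp add: dist_real_def)
    then have "\<mu> \<le> \<mu> - e / 2" unfolding \<mu>_def by (rule cInf_lower[OF _ bdd])
    then show False using e(1) by simp
  qed
  then have ex: "\<exists>k. k \<le> Suc i \<and> radial d \<mu> k \<le> 0" by (auto simp: S_def not_less)
  \<comment> \<open>The first level where positivity fails; by \<open>nonneg\<close> the value there
    is exactly 0.\<close>
  define k where "k = (LEAST k. k \<le> Suc i \<and> radial d \<mu> k \<le> 0)"
  have k: "k \<le> Suc i" "radial d \<mu> k = 0"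
    using LeastI_ex[OF ex] nonneg[of k] by (auto simp: k_def[symmetric])
  obtain l where l: "k = Suc l" using k(2) by (cases k) auto
  have "radial d \<mu> l > 0"
    using not_less_Least[of l "\<lambda>k. k \<le> Suc i \<and> radial d \<mu> k \<le> 0"] k(1) l
    by (auto simp: k_def[symmetric])
  \<comment> \<open>On a lower level, a zero preceded by a positive value would force the next value
    to be negative.\<close>
  have "k = Suc i"
  proof (rule ccontr)
    assume "k \<noteq> Suc i"
    then have "k \<le> i" using k(1) by simp
    have "real k * radial d \<mu> l + (real d - real k) * radial d \<mu> (Suc k) = 0"
      using radial_rec[of k d \<mu>] \<open>k \<le> i\<close> assms(1) k(2) l by simp
    moreover have "real k * radial d \<mu> l > 0" using \<open>radial d \<mu> l > 0\<close> l by simp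
    moreover have "(real d - real k) * radial d \<mu> (Suc k) \<ge> 0"
      using nonneg[of "Suc k"] \<open>k \<le> i\<close> assms(1) by simp
    ultimately show False by linarith
  qed
  then have "graph_eigenvalue (hamming_ball d i) \<mu>"
    using k(2) assms(1) by (intro hamming_ball_radial_eigenvalue) auto
  moreover have "L \<le> \<mu>" unfolding \<mu>_def using ne lb by (rule cInf_greatest)
  ultimately show ?thesis using L_iff by blast
qed

section \<open>Bounds on the largest eigenvalue and the asymptotics\<close>

text \<open>The existence result with \<open>s = 0\<close> only supplies some eigenvalue, so that
  \<open>lambda1\<close> is itself an eigenvalue and the weight bound applies to it.\<close>

lemma lambda1_hamming_ball_le:
  assumes "i < d" "2 * i \<le> d"
  shows "lambda1 (hamming_ball d i) \<le> 2 * level_weight d i"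
  using hamming_ball_eigenvalue_ge[OF assms(1) _ assms(2), of 0]
    lambda1_greatest_eigenvalue(1)[OF finite_verts_hamming_ball]
    hamming_ball_eigenvalue_le[OF assms(2)] by blast

lemma lambda1_hamming_ball_ge:
  assumes "i \<ge> 1" "2 * i \<le> d"
  shows "2 * level_weight d i * (1 - 2 / sqrt (real i)) \<le> lambda1 (hamming_ball d i)"
proof -
  \<comment> \<open>This choice balances the two losses: \<open>s / (s + 1)\<close> and
    \<open>1 - s / i\<close> are both about \<open>1 - 1 / sqrt i\<close>.\<close>
  define s where "s = nat \<lfloor>sqrt (real i)\<rfloor>"
  have s: "real s \<le> sqrt (real i)" "sqrt (real i) \<le> real s + 1" by (auto simp: s_def)
  have i1: "sqrt (real i) \<ge> 1" using assms(1) by simp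
  then have s1: "s \<ge> 1" by (simp add: s_def le_nat_iff le_floor_iff)
  have "sqrt (real i) \<le> real i"
    using mult_right_mono[OF i1, of "sqrt (real i)"] by simp
  then have si: "s \<le> i" using s(1) by simp
  obtain \<mu> where \<mu>: "graph_eigenvalue (hamming_ball d i) \<mu>"
    "2 * real s * level_weight d (i - s + 1) \<le> (real s + 1) * \<mu>"
    using hamming_ball_eigenvalue_ge[of i d s] assms si by auto
  \<comment> \<open>Lower bound for the ratio of the level weights: the radicands give the square
    root of \<open>r\<close>, which \<open>r \<le> 1\<close> weakens to \<open>r\<close>.\<close>
  define r where "r = 1 - real s / real i"
  have r: "0 \<le> r" "r \<le> 1" "r * real i = real i - real s"
    using si assms(1) by (auto simp: r_def field_simps)
  have b: "r * level_weight d i \<le> level_weight d (i - s + 1)"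
  proof -
    have "r * level_weight d i = sqrt (r ^ 2 * (real i * (real d + 1 - real i)))"
      using r(1) by (simp add: level_weight_def real_sqrt_mult)
    also have "\<dots> \<le> level_weight d (i - s + 1)"
      unfolding level_weight_def
    proof (rule real_sqrt_le_mono)
      have "r ^ 2 * (real i * (real d + 1 - real i)) \<le> r * (real i * (real d + 1 - real i))"
        using r assms(2) by (intro mult_right_mono) (auto simp: power2_eq_square mult_left_le)
      also have "\<dots> = (real i - real s) * (real d + 1 - real i)"
        using r(3) by (simp add: mult.assoc[symmetric])
      also have "\<dots> \<le> (real i - real s + 1) * (real d - real i + real s)"
        using si s1 assms(2) by (intro mult_mono) auto
      finally show "r\<^sup>2 * (real i * (real d + 1 - real i)) \<le>
          real (i - s + 1) * (real d + 1 - real (i - s + 1))"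
        using si by (simp add: of_nat_diff algebra_simps)
    qed
    finally show ?thesis .
  qed
  define c where "c = real s / (real s + 1)"
  have c: "c = 1 - 1 / (real s + 1)" "0 \<le> c" by (auto simp: c_def field_simps)
  have small: "1 / (real s + 1) \<le> 1 / sqrt (real i)" "real s / real i \<le> 1 / sqrt (real i)"
  proof -
    show "1 / (real s + 1) \<le> 1 / sqrt (real i)" using s(2) i1 by (intro divide_left_mono) auto
    have "real s / real i \<le> sqrt (real i) / real i" using s(1) by (intro divide_right_mono) auto
    also have "\<dots> = 1 / sqrt (real i)" using assms(1) by (simp add: field_simps)
    finally show "real s / real i \<le> 1 / sqrt (real i)" .
  qed
  \<comment> \<open>Dropping the nonnegative cross term leaves two losses of at most
    \<open>1 / sqrt i\<close> each.\<close>
  have "c * r = 1 - 1 / (real s + 1) - real s / real i + (1 / (real s + 1)) * (real s / real i)"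
    by (simp add: c(1) r_def algebra_simps)
  moreover have "0 \<le> (1 / (real s + 1)) * (real s / real i)" by simp
  ultimately have "1 - 2 / sqrt (real i) \<le> c * r" using small by linarith
  then have "2 * level_weight d i * (1 - 2 / sqrt (real i)) \<le> 2 * level_weight d i * (c * r)"
    using level_weight_nonneg[of i d] assms(2) by (intro mult_left_mono) auto
  also have "\<dots> = 2 * c * (r * level_weight d i)" by simp
  also have "\<dots> \<le> 2 * c * level_weight d (i - s + 1)"
    using b c(2) by (intro mult_left_mono) auto
  also have "\<dots> \<le> \<mu>" using \<mu>(2) by (simp add: c_def field_simps)
  also have "\<dots> \<le> lambda1 (hamming_ball d i)"
    by (rule lambda1_greatest_eigenvalue(2)[OF finite_verts_hamming_ball \<mu>(1)])
  finally show ?thesis .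
qed

theorem theorem1p2:
  shows "\<exists>\<epsilon> :: nat \<times> nat \<Rightarrow> real.
    \<epsilon> \<in> O[half_filter](\<lambda>(d, i). real i powr (-1/2) * ln (real i) powr (1/2)) \<and>
    (\<forall>\<^sub>F (d, i) in half_filter.
       lambda1 (hamming_ball d i) = 2 * sqrt (real i * (real d + 1 - real i)) * (1 + \<epsilon> (d, i)))"
proof -
  \<comment> \<open>The exact relative error; the required identity is a rearrangement wherever the
    level weight is nonzero.\<close>
  define \<epsilon> where
    "\<epsilon> = (\<lambda>(d, i). lambda1 (hamming_ball d i) / (2 * level_weight d i) - 1)"
  have pos: "level_weight d i > 0" if "i \<ge> 3" "real i \<le> real d / 2" for d i
    using that by (simp add: level_weight_def)
  have bound: "\<bar>\<epsilon> (d, i)\<bar> \<le> 2 * \<bar>real i powr (-1/2) * ln (real i) powr (1/2)\<bar>"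
    if i: "i \<ge> 3" "real i \<le> real d / 2" for d i
  proof -
    have d: "2 * i \<le> d" "i < d" using i by linarith+
    have "\<epsilon> (d, i) \<le> 0"
      using lambda1_hamming_ball_le[OF d(2,1)] pos[OF i] by (simp add: \<epsilon>_def)
    moreover have "1 - 2 / sqrt (real i) \<le> lambda1 (hamming_ball d i) / (2 * level_weight d i)"
      using lambda1_hamming_ball_ge[of i d] d(1) i(1) pos[OF i]
      by (simp add: pos_le_divide_eq mult_ac)
    moreover have "real i powr (-1/2) = 1 / sqrt (real i)"
      by (simp add: powr_minus_divide powr_half_sqrt)
    ultimately have "\<bar>\<epsilon> (d, i)\<bar> \<le> 2 * real i powr (-1/2)"
      by (simp add: \<epsilon>_def)
    also have "\<dots> \<le> 2 * (real i powr (-1/2) * ln (real i) powr (1/2))"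
    proof -
      \<comment> \<open>The threshold 3 exceeds e, so the logarithmic factor is at least 1 and only
        enlarges the bound.\<close>
      have "exp 1 \<le> real i" using exp_le i(1) by linarith
      then have "1 \<le> ln (real i)" using i(1) by (subst ln_ge_iff) auto
      then have "1 \<le> ln (real i) powr (1/2)" by (simp add: ge_one_powr_ge_zero)
      then show ?thesis by (simp add: mult_le_cancel_left1)
    qed
    finally show ?thesis by simp
  qed
  show ?thesis
  proof (intro exI[of _ \<epsilon>] conjI)
    show "\<epsilon> \<in> O[half_filter](\<lambda>(d, i). real i powr (-1/2) * ln (real i) powr (1/2))"
    proof (rule bigoI[where c = 2])
      show "\<forall>\<^sub>F p in half_filter. norm (\<epsilon> p) \<le>
          2 * norm (case p of (d, i) \<Rightarrow> real i powr (-1/2) * ln (real i) powr (1/2))"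
        unfolding eventually_half_filter using bound by (intro exI[of _ 3]) auto
    qed
    show "\<forall>\<^sub>F (d, i) in half_filter.
       lambda1 (hamming_ball d i) = 2 * sqrt (real i * (real d + 1 - real i)) * (1 + \<epsilon> (d, i))"
      unfolding eventually_half_filter
    proof (intro exI[of _ 3] allI impI)
      fix d i :: nat assume "3 \<le> i" "real i \<le> real d / 2"
      then show "case (d, i) of (d, i) \<Rightarrow> lambda1 (hamming_ball d i) =
          2 * sqrt (real i * (real d + 1 - real i)) * (1 + \<epsilon> (d, i))"
        using pos[of i d] by (simp add: \<epsilon>_def flip: level_weight_def)
    qed
  qed
qed

end
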